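(* Let $G$ be a graph and $k\ge0$ an integer. If at some point of the game, after a cop move, the cop has $k$-cornered the robber or has $(k+1)$-caught the robber, then the cop can guarantee a win in at most $k$ more moves.
   Context: All graphs are finite, nonempty and reflexive (every vertex adjacent to itself). For distinct vertices $v,w$ of a graph $H$: $w$ corners $v$ in $H$ if every vertex of $H$ adjacent to $v$ is adjacent to $w$; $w$ strictly corners $v$ in $H$ if moreover some vertex of $H$ adjacent to $w$ is not adjacent to $v$; a strict corner of $H$ is a vertex strictly cornered in $H$ by another vertex. We also say $c$ corners $x$ in $H$ when $c=x$. Corner ranking: $G_1=G$, $k=1$. If $G_k$ is a clique, its vertices get rank $k$; stop. Else if $G_k$ has no strict corners, its vertices get rank $\infty$; stop. Else the set $X$ of strict corners of $G_k$ gets rank $k$, $G_{k+1}=G_k-X$, increase $k$, repeat. $\mathrm{cr}(v)$ is the rank of $v$. Projections: for $k$ with $G_{k+1}$ defined, $f_k(\{u\})=\{u\}$ if $\mathrm{cr}(u)>k$, otherwise the set of vertices of $G_{k+1}$ that strictly corner $u$ in $G_k$ ($u\in V(G_k)$); $f_k(S)=\bigcup_{u\in S}f_k(\{u\})$; $F_1$ the identity on nonempty subsets of $V(G)$, $F_k=f_{k-1}\circ\cdots\circ f_1$, $F_k(v)=F_k(\{v\})$. Game: cop places, robber places, then alternate moves with the cop first; a move is staying or moving to an adjacent vertex; cop wins when both share a vertex. With the cop at $c$ and robber at $x$: $x$ is $0$-cornered by $c$ if $c=x$; for $k\ge1$, $x$ is $k$-cornered by $c$ if some $x'\in F_k(x)$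 is cornered by $c$ in the subgraph induced by $V(G_k)\cup\{c\}$. For $k\ge1$, the cop has $k$-caught the robber if $c\in F_k(x)$. *)

theory Defs
  imports Main "HOL-Library.Extended_Nat"
begin

definition reflexive_graph :: "'a set \<Rightarrow> ('a \<times> 'a) set \<Rightarrow> bool" where
  "reflexive_graph V E \<longleftrightarrow>
     finite V \<and> V \<noteq> {} \<and> E \<subseteq> V \<times> V \<and> refl_on V E \<and> sym E"

text \<open>Induced subgraphs of the graph \<open>(V, E)\<close> are represented by their vertex sets \<open>W\<close>;
  adjacency in them is \<open>E\<close> restricted to \<open>W\<close>.\<close>

definition is_clique :: "('a \<times> 'a) set \<Rightarrow> 'a set \<Rightarrow> bool" where
  "is_clique E W \<longleftrightarrow> (\<forall>u\<in>W. \<forall>v\<in>W. (u, v) \<in> E)"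

text \<open>\<open>corners E W w v\<close>: the vertex \<open>w\<close> corners the distinct vertex \<open>v\<close> in the
  subgraph induced by \<open>W\<close>.\<close>

definition corners :: "('a \<times> 'a) set \<Rightarrow> 'a set \<Rightarrow> 'a \<Rightarrow> 'a \<Rightarrow> bool" where
  "corners E W w v \<longleftrightarrow>
     w \<in> W \<and> v \<in> W \<and> w \<noteq> v \<and> (\<forall>u\<in>W. (u, v) \<in> E \<longrightarrow> (u, w) \<in> E)"

definition strictly_corners :: "('a \<times> 'a) set \<Rightarrow> 'a set \<Rightarrow> 'a \<Rightarrow> 'a \<Rightarrow> bool" where
  "strictly_corners E W w v \<longleftrightarrow>
     corners E W w v \<and> (\<exists>u\<in>W. (u, w) \<in> E \<and> (u, v) \<notin> E)"

definition strict_corners :: "('a \<times> 'a) set \<Rightarrow> 'a set \<Rightarrow> 'a set" where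
  "strict_corners E W = {v. \<exists>w. strictly_corners E W w v}"

text \<open>\<open>stage V E k\<close> is the vertex set of \<open>G\<^sub>k\<close> (for \<open>k \<ge> 1\<close>), and \<open>None\<close> if the ranking
  procedure has stopped before reaching \<open>G\<^sub>k\<close>.\<close>

fun stage :: "'a set \<Rightarrow> ('a \<times> 'a) set \<Rightarrow> nat \<Rightarrow> 'a set option" where
  "stage V E 0 = None"
| "stage V E (Suc 0) = Some V"
| "stage V E (Suc (Suc k)) =
     (case stage V E (Suc k) of
        None \<Rightarrow> None
      | Some W \<Rightarrow>
          if is_clique E W \<or> strict_corners E W = {} then None
          else Some (W - strict_corners E W))"

definition gets_rank :: "'a set \<Rightarrow> ('a \<times> 'a) set \<Rightarrow> 'a \<Rightarrow> nat \<Rightarrow> bool" where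
  "gets_rank V E v k \<longleftrightarrow>
     (\<exists>W. stage V E k = Some W \<and>
          (if is_clique E W then v \<in> W else v \<in> strict_corners E W))"

text \<open>The procedure terminates on a finite graph, so a vertex that gets no finite rank
  is one that is left over in a final stage without strict corners.\<close>

definition cr :: "'a set \<Rightarrow> ('a \<times> 'a) set \<Rightarrow> 'a \<Rightarrow> enat" where
  "cr V E v =
     (if \<exists>k. gets_rank V E v k then enat (THE k. gets_rank V E v k) else \<infinity>)"

text \<open>\<open>proj V E k\<close> is \<open>f\<^sub>k\<close>, meaningful only if \<open>G\<^bsub>k+1\<^esub>\<close> is defined; likewise
  \<open>projs V E k\<close> is \<open>F\<^sub>k\<close>, meaningful only if \<open>G\<^sub>k\<close> is defined.\<close>

definition proj_vertex :: "'a set \<Rightarrow> ('a \<times> 'a) set \<Rightarrow> nat \<Rightarrow> 'a \<Rightarrow> 'a set" where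
  "proj_vertex V E k u =
     (if cr V E u > enat k then {u}
      else {w. \<exists>W W'. stage V E k = Some W \<and> stage V E (Suc k) = Some W' \<and>
                 w \<in> W' \<and> strictly_corners E W w u})"

definition proj :: "'a set \<Rightarrow> ('a \<times> 'a) set \<Rightarrow> nat \<Rightarrow> 'a set \<Rightarrow> 'a set" where
  "proj V E k S = (\<Union>u\<in>S. proj_vertex V E k u)"

fun projs :: "'a set \<Rightarrow> ('a \<times> 'a) set \<Rightarrow> nat \<Rightarrow> 'a set \<Rightarrow> 'a set" where
  "projs V E 0 S = {}"
| "projs V E (Suc 0) S = S"
| "projs V E (Suc (Suc k)) S = proj V E (Suc k) (projs V E (Suc k) S)"

text \<open>Both notions below fail (for \<open>k \<ge> 1\<close>) when \<open>G\<^sub>k\<close> is not defined.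
  The disjunct \<open>c = x'\<close> is the convention that every vertex corners itself.\<close>

definition k_cornered :: "'a set \<Rightarrow> ('a \<times> 'a) set \<Rightarrow> nat \<Rightarrow> 'a \<Rightarrow> 'a \<Rightarrow> bool" where
  "k_cornered V E k c x \<longleftrightarrow>
     (if k = 0 then c = x
      else (\<exists>W. stage V E k = Some W \<and>
              (\<exists>x'\<in>projs V E k {x}. c = x' \<or> corners E (insert c W) c x')))"

definition k_caught :: "'a set \<Rightarrow> ('a \<times> 'a) set \<Rightarrow> nat \<Rightarrow> 'a \<Rightarrow> 'a \<Rightarrow> bool" where
  "k_caught V E k c x \<longleftrightarrow> stage V E k \<noteq> None \<and> c \<in> projs V E k {x}"

text \<open>Positions \<open>(c, x)\<close> are (cop, robber) and are recorded after a cop move.  A cop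
  strategy \<open>s\<close> sees the list of these positions so far (latest last) and the vertex the
  robber has just moved to, and returns the vertex the cop moves to.\<close>

type_synonym 'a cop_strategy = "('a \<times> 'a) list \<Rightarrow> 'a \<Rightarrow> 'a"

definition legal_cop_strategy ::
    "'a set \<Rightarrow> ('a \<times> 'a) set \<Rightarrow> 'a cop_strategy \<Rightarrow> bool" where
  "legal_cop_strategy V E s \<longleftrightarrow>
     (\<forall>h. \<forall>c\<in>V. \<forall>x\<in>V. \<forall>x'\<in>V. (x, x') \<in> E \<longrightarrow> (c, s (h @ [(c, x)]) x') \<in> E)"

text \<open>\<open>C i\<close> and \<open>R i\<close> are the positions after \<open>i\<close> further rounds, each consisting of a
  robber move from \<open>R i\<close> to \<open>R (Suc i)\<close> followed by a cop move from \<open>C i\<close> to \<open>C (Suc i)\<close>.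
  What happens after a capture is irrelevant.\<close>

definition play_from ::
    "('a \<times> 'a) set \<Rightarrow> 'a cop_strategy \<Rightarrow> 'a \<Rightarrow> 'a \<Rightarrow> (nat \<Rightarrow> 'a) \<Rightarrow> (nat \<Rightarrow> 'a) \<Rightarrow> bool" where
  "play_from E s c x C R \<longleftrightarrow>
     C 0 = c \<and> R 0 = x \<and>
     (\<forall>i. (R i, R (Suc i)) \<in> E \<and>
          C (Suc i) = s (map (\<lambda>j. (C j, R j)) [0..<Suc i]) (R (Suc i)))"

text \<open>From the position \<open>(c, x)\<close> with the robber to move, the cop has a strategy that
  wins no later than the cop's \<open>k\<close>-th move.  The disjunct with \<open>R (Suc i)\<close> is
  the case where the robber moves onto the cop.\<close>

definition cop_can_win_within ::
    "'a set \<Rightarrow> ('a \<times> 'a) set \<Rightarrow> nat \<Rightarrow> 'a \<Rightarrow> 'a \<Rightarrow> bool" where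
  "cop_can_win_within V E k c x \<longleftrightarrow>
     (\<exists>s. legal_cop_strategy V E s \<and>
        (\<forall>C R. play_from E s c x C R \<longrightarrow>
           (\<exists>i\<le>k. C i = R i \<or> (i < k \<and> C i = R (Suc i)))))"

end

(* Projections carry adjacent vertices to adjacent vertices: if w corners u and w' corners u',
   then u ~ u' gives w ~ u' and hence w ~ w'. So if the cop at c corners a shadow x' in F_k(x) and
   the robber moves from x to y, every shadow y' in F_k(y) is adjacent to x', hence to c. The cop
   moves to y' and has k-caught the robber; but a (k+1)-caught robber is always k-cornered, so
   the cornering level drops by one with every cop move. *)

theory Submission imports Defs begin

section \<open>Strict cornering and vertex degrees\<close>

lemma strictly_corners_trans:
  assumes "strictly_corners E W w v" "strictly_corners E W v u"
  shows "strictly_corners E W w u"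
  using assms unfolding strictly_corners_def corners_def by blast

lemma strictly_corners_card_less:
  assumes "finite W" "strictly_corners E W w v"
  shows "card {u\<in>W. (u, v) \<in> E} < card {u\<in>W. (u, w) \<in> E}"
  by (rule psubset_card_mono)
     (use assms in \<open>auto simp: strictly_corners_def corners_def\<close>)

text \<open>Among the vertices strictly cornering \<open>v\<close>, take one of maximal degree in
  \<open>W\<close>. A vertex strictly cornering it would, by transitivity, also strictly corner
  \<open>v\<close>, with larger degree. This keeps the projection of a strict corner from being
  empty.\<close>

lemma strict_corner_has_surviving_corner:
  assumes "finite W" "v \<in> strict_corners E W"
  obtains w where "w \<in> W - strict_corners E W" "strictly_corners E W w v"
proof -
  let ?S = "{w. strictly_corners E W w v}"
  let ?d = "\<lambda>w. card {u\<in>W. (u, w) \<in> E}"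
  have sub: "?S \<subseteq> W"
    by (auto simp: strictly_corners_def corners_def)
  have fin: "finite (?d ` ?S)"
    by (rule finite_imageI[OF finite_subset[OF sub assms(1)]])
  have "?d ` ?S \<noteq> {}"
    using assms(2) unfolding strict_corners_def by blast
  from Max_in[OF fin this] obtain w where w: "w \<in> ?S" "Max (?d ` ?S) = ?d w"
    by blast
  have max: "?d w' \<le> ?d w" if "w' \<in> ?S" for w'
    using Max_ge[OF fin] that unfolding w(2) by blast
  have "w \<notin> strict_corners E W"
  proof
    assume "w \<in> strict_corners E W"
    then obtain w' where w': "strictly_corners E W w' w"
      by (auto simp: strict_corners_def)
    then have "w' \<in> ?S" using strictly_corners_trans[OF w'] w(1) by blast
    from max[OF this] strictly_corners_card_less[OF assms(1) w'] show False by linarith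
  qed
  then show thesis using that[of w] w(1) sub by blast
qed

section \<open>Stages of the corner ranking and ranks\<close>

lemma stage_SucD:
  assumes "stage V E (Suc k) = Some W'" "k \<ge> 1"
  obtains W where "stage V E k = Some W" "\<not> is_clique E W" "W' = W - strict_corners E W"
  using assms by (cases k) (auto split: option.splits if_splits)

lemma stage_antimono:
  assumes "stage V E k = Some W" "1 \<le> j" "j \<le> k"
  shows "\<exists>W'. stage V E j = Some W' \<and> W \<subseteq> W'"
  using assms(3,2,1)
proof (induction k arbitrary: W rule: dec_induct)
  case base
  then show ?case by blast
next
  case (step n)
  then obtain W' where "stage V E n = Some W'" "W \<subseteq> W'"
    by (auto elim!: stage_SucD)
  with step show ?case by blast
qed

lemma stage_subset:
  assumes "stage V E k = Some W"
  shows "W \<subseteq> V"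
proof -
  have "1 \<le> k" using assms by (cases k) auto
  then show ?thesis using stage_antimono[OF assms, of 1] by simp
qed

lemma gets_rank_stageD:
  assumes "gets_rank V E v k"
  shows "\<exists>W. stage V E k = Some W \<and> v \<in> W"
  using assms
  by (auto simp: gets_rank_def strict_corners_def strictly_corners_def corners_def
      split: if_splits)

text \<open>A later stage exists, so stage \<open>j\<close> is not a clique. Rank \<open>j\<close>
  thus means being a strict corner there, and strict corners are deleted at once; stages only shrink
  afterwards.\<close>

lemma gets_rank_not_in_later_stage:
  assumes "gets_rank V E v j" "j < k" "stage V E k = Some W"
  shows "v \<notin> W"
proof -
  have j: "j \<ge> 1" using assms(1) by (cases j) (auto simp: gets_rank_def)
  obtain W' where W': "stage V E (Suc j) = Some W'" "W \<subseteq> W'"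
    using stage_antimono[OF assms(3), of "Suc j"] assms(2) by auto
  then obtain U where "stage V E j = Some U" "\<not> is_clique E U" "W' = U - strict_corners E U"
    using j stage_SucD by blast
  then show ?thesis using assms(1) W' by (auto simp: gets_rank_def)
qed

text \<open>This is what makes the \<open>THE\<close> in \<open>cr\<close> well defined.\<close>

lemma gets_rank_unique:
  assumes "gets_rank V E v j" "gets_rank V E v k"
  shows "j = k"
proof -
  have "\<not> i < l" if "gets_rank V E v i" "gets_rank V E v l" for i l
    using gets_rank_stageD[OF that(2)] gets_rank_not_in_later_stage[OF that(1)] by blast
  from this[OF assms] this[OF assms(2,1)] show ?thesis by simp
qed

lemma cr_eq:
  assumes "gets_rank V E v k"
  shows "cr V E v = enat k"
proof -
  have "(THE k. gets_rank V E v k) = k"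
    using assms gets_rank_unique[OF _ assms] by (rule the_equality)
  then show ?thesis using assms by (auto simp: cr_def)
qed

text \<open>Replaces the rank test in \<open>proj_vertex\<close> by membership in a stage. A vertex
  that survives has a rank above \<open>k\<close> or none at all, and in the latter case
  \<open>cr\<close> is infinite.\<close>

lemma cr_gt_iff_in_next_stage:
  assumes "stage V E k = Some W" "stage V E (Suc k) = Some W'" "v \<in> W"
  shows "cr V E v > enat k \<longleftrightarrow> v \<in> W'"
proof
  have k: "k \<ge> 1" using assms(1) by (cases k) auto
  from assms(1,2) k have W: "\<not> is_clique E W" "W' = W - strict_corners E W"
    by (auto elim!: stage_SucD)
  {
    assume "cr V E v > enat k"
    show "v \<in> W'"
    proof (rule ccontr)
      assume "v \<notin> W'"
      then have "gets_rank V E v k" using W assms by (auto simp: gets_rank_def)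
      then show False using cr_eq \<open>cr V E v > enat k\<close> by fastforce
    qed
  }
  assume "v \<in> W'"
  show "cr V E v > enat k"
  proof (cases "\<exists>j. gets_rank V E v j")
    case True
    then obtain j where j: "gets_rank V E v j" by blast
    then have "\<not> j < Suc k"
      using gets_rank_not_in_later_stage[OF _ _ assms(2)] \<open>v \<in> W'\<close> by blast
    then show ?thesis using cr_eq[OF j] by simp
  qed (simp add: cr_def)
qed

section \<open>Projections\<close>

lemma proj_vertex_eq:
  assumes "stage V E k = Some W" "stage V E (Suc k) = Some W'" "u \<in> W"
  shows "proj_vertex V E k u =
    (if u \<in> W' then {u} else {w\<in>W'. strictly_corners E W w u})"
  using assms cr_gt_iff_in_next_stage[OF assms] by (auto simp: proj_vertex_def)

lemma proj_vertex_nonempty: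
  assumes "finite V" "stage V E k = Some W" "stage V E (Suc k) = Some W'" "u \<in> W"
  shows "proj_vertex V E k u \<noteq> {}"
proof -
  have "k \<ge> 1" using assms(2) by (cases k) auto
  then have W': "W' = W - strict_corners E W"
    using assms by (auto elim!: stage_SucD)
  have "finite W" using assms stage_subset finite_subset by metis
  then show ?thesis
    using strict_corner_has_surviving_corner[of W u E] W' assms(4)
    unfolding proj_vertex_eq[OF assms(2-4)] by auto
qed

lemma proj_vertex_adjacent:
  assumes "sym E" "stage V E k = Some W" "stage V E (Suc k) = Some W'"
    and "u \<in> W" "v \<in> W" "(u, v) \<in> E"
    and "u' \<in> proj_vertex V E k u" "v' \<in> proj_vertex V E k v"
  shows "(u', v') \<in> E"
proof -
  have u': "u' = u \<or> strictly_corners E W u' u"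
    using assms(7) proj_vertex_eq[OF assms(2,3,4)] by (auto split: if_splits)
  have v': "v' = v \<or> strictly_corners E W v' v"
    using assms(8) proj_vertex_eq[OF assms(2,3,5)] by (auto split: if_splits)
  have "(v, u') \<in> E"
    using u' assms(5,6) symD[OF assms(1)] by (auto simp: strictly_corners_def corners_def)
  \<comment> \<open>Cornering of \<open>v\<close> by \<open>v'\<close> concerns only vertices of
    \<open>W\<close>, so \<open>u'\<close> must lie there before \<open>v\<close> can be exchanged
    for \<open>v'\<close>.\<close>
  moreover have "u' \<in> W"
    using u' assms(4) by (auto simp: strictly_corners_def corners_def)
  ultimately show ?thesis
    using v' symD[OF assms(1)] by (auto simp: strictly_corners_def corners_def)
qed

lemma projs_subset_stage:
  assumes "stage V E k = Some W" "S \<subseteq> V"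
  shows "projs V E k S \<subseteq> W"
  using assms
\<comment> \<open>\<open>stage\<close> and \<open>projs\<close> recurse through the same three
  cases; index 0 is vacuous because \<open>stage\<close> is \<open>None\<close> there.\<close>
proof (induction V E k arbitrary: W rule: stage.induct)
  case (3 V E k)
  then obtain W0 where W0: "stage V E (Suc k) = Some W0" by (auto split: option.splits)
  have sub: "projs V E (Suc k) S \<subseteq> W0" using 3 W0 by blast
  show ?case
  proof
    fix w assume "w \<in> projs V E (Suc (Suc k)) S"
    then obtain u where u: "u \<in> projs V E (Suc k) S" "w \<in> proj_vertex V E (Suc k) u"
      by (auto simp: proj_def)
    then show "w \<in> W"
      using proj_vertex_eq[OF W0 "3.prems"(1)] sub by (auto split: if_splits)
  qed
qed simp_all

lemma projs_nonempty:
  assumes "finite V" "stage V E k = Some W" "S \<subseteq> V" "S \<noteq> {}"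
  shows "projs V E k S \<noteq> {}"
  using assms
proof (induction V E k arbitrary: W rule: stage.induct)
  case (3 V E k)
  then obtain W0 where W0: "stage V E (Suc k) = Some W0" by (auto split: option.splits)
  then obtain u where u: "u \<in> projs V E (Suc k) S" using 3 by blast
  then have "u \<in> W0" using projs_subset_stage[OF W0 "3.prems"(3)] by blast
  then show ?case
    using proj_vertex_nonempty[OF "3.prems"(1) W0 "3.prems"(2)] u unfolding projs.simps proj_def by blast
qed simp_all

lemma projs_adjacent:
  assumes "sym E" "stage V E k = Some W" "u \<in> V" "v \<in> V" "(u, v) \<in> E"
    and "u' \<in> projs V E k {u}" "v' \<in> projs V E k {v}"
  shows "(u', v') \<in> E"
  using assms
proof (induction V E k arbitrary: W u' v' rule: stage.induct)
  case (3 V E k)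
  then obtain W0 where W0: "stage V E (Suc k) = Some W0" by (auto split: option.splits)
  obtain a b where ab: "a \<in> projs V E (Suc k) {u}" "u' \<in> proj_vertex V E (Suc k) a"
      "b \<in> projs V E (Suc k) {v}" "v' \<in> proj_vertex V E (Suc k) b"
    using 3 by (auto simp: proj_def)
  have "a \<in> W0" "b \<in> W0"
    using ab projs_subset_stage[OF W0] "3.prems"(3,4) by auto
  moreover have "(a, b) \<in> E" using 3 W0 ab by blast
  ultimately show ?case
    using proj_vertex_adjacent[OF "3.prems"(1) W0 "3.prems"(2)] ab by blast
qed simp_all

section \<open>Catching, cornering and the strategy of the cop\<close>

lemma k_caught_Suc_imp_k_cornered:
  assumes "k_caught V E (Suc k) c x" "x \<in> V"
  shows "k_cornered V E k c x"
proof (cases k)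
  case 0
  then show ?thesis using assms by (simp add: k_caught_def k_cornered_def)
next
  case (Suc j)
  then obtain W' where W': "stage V E (Suc k) = Some W'" using assms by (auto simp: k_caught_def)
  then obtain W where W: "stage V E k = Some W" using Suc by (auto split: option.splits)
  obtain x' where x': "x' \<in> projs V E k {x}" "c \<in> proj_vertex V E k x'"
    using assms Suc by (auto simp: k_caught_def proj_def)
  have "x' \<in> W" using projs_subset_stage[OF W, of "{x}"] assms(2) x'(1) by blast
  then have "c = x' \<or> strictly_corners E W c x'"
    using x'(2) by (auto simp: proj_vertex_eq[OF W W'] split: if_splits)
  \<comment> \<open>A strictly cornering \<open>c\<close> already belongs to \<open>W\<close>, so
    inserting it changes nothing.\<close>
  then have "c = x' \<or> corners E (insert c W) c x'"
    by (auto simp: strictly_corners_def corners_def insert_absorb)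
  then show ?thesis using W x'(1) \<open>k = Suc j\<close> unfolding k_cornered_def by auto
qed

text \<open>The reply is any vertex of the projection of \<open>y\<close>. Level 0 is excluded:
  there the cop has already won, and \<open>k_caught\<close> is false.\<close>

lemma k_cornered_cop_reply:
  assumes "reflexive_graph V E" "k_cornered V E k c x" "k \<ge> 1" "(x, y) \<in> E"
  shows "\<exists>c'. (c, c') \<in> E \<and> k_caught V E k c' y"
proof -
  have graph: "finite V" "sym E" "x \<in> V" "y \<in> V"
    using assms(1,4) by (auto simp: reflexive_graph_def)
  obtain W x' where W: "stage V E k = Some W" and x': "x' \<in> projs V E k {x}"
    and c: "c = x' \<or> corners E (insert c W) c x'"
    using assms(2,3) by (auto simp: k_cornered_def)
  obtain y' where y': "y' \<in> projs V E k {y}"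
    using projs_nonempty[OF graph(1) W, of "{y}"] graph(4) by auto
  have "(y', x') \<in> E"
    using projs_adjacent[OF graph(2) W graph(3,4) assms(4) x' y'] graph(2) by (auto dest: symD)
  \<comment> \<open>The cop's vertex \<open>c\<close> may lie outside \<open>W\<close>, but its
    cornering of \<open>x'\<close> still covers every neighbour of \<open>x'\<close> in
    \<open>W\<close>.\<close>
  moreover have "y' \<in> W" using projs_subset_stage[OF W, of "{y}"] graph(4) y' by blast
  ultimately have "(c, y') \<in> E" using c graph(2) by (auto simp: corners_def dest: symD)
  then show ?thesis using W y' by (auto simp: k_caught_def)
qed

text \<open>After \<open>i\<close> rounds the history has length \<open>i + 1\<close>, so \<open>k + 1 - length h\<close> is the number of
  cop moves still available.\<close>

definition catching_strategy :: "'a set \<Rightarrow> ('a \<times> 'a) set \<Rightarrow> nat \<Rightarrow> 'a cop_strategy" where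
  "catching_strategy V E k h y =
     (let c = fst (last h);
          P = (\<lambda>c'. (c, c') \<in> E \<and> k_caught V E (k + 1 - length h) c' y)
      in if Ex P then Eps P else c)"

text \<open>Legality is demanded for every history, including those without a catching reply; there
  the cop stays put, which reflexivity allows.\<close>

lemma legal_catching_strategy:
  assumes "reflexive_graph V E"
  shows "legal_cop_strategy V E (catching_strategy V E k)"
proof -
  have "(c, c) \<in> E" if "c \<in> V" for c
    using assms that by (auto simp: reflexive_graph_def refl_on_def)
  moreover have "(c, SOME c'. (c, c') \<in> E \<and> Q c') \<in> E" if "\<exists>c'. (c, c') \<in> E \<and> Q c'"
    for c :: 'a and Q
    using someI_ex[OF that] by blast
  ultimately show ?thesis
    by (simp add: legal_cop_strategy_def catching_strategy_def Let_def)
qed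

text \<open>The invariant of the play: the cornering level equals the number of cop moves
  left.\<close>

lemma catching_strategy_keeps_cornered:
  assumes "reflexive_graph V E" "k_cornered V E k c x"
    and "play_from E (catching_strategy V E k) c x C R" "i \<le> k"
  shows "k_cornered V E (k - i) (C i) (R i)"
  using assms(4)
proof (induction i)
  case 0
  then show ?case using assms by (simp add: play_from_def)
next
  case (Suc i)
  let ?P = "\<lambda>c'. (C i, c') \<in> E \<and> k_caught V E (k - i) c' (R (Suc i))"
  have move: "(R i, R (Suc i)) \<in> E"
    using assms(3) by (simp add: play_from_def)
  have ex: "Ex ?P"
    using k_cornered_cop_reply[OF assms(1) _ _ move, of "k - i" "C i"] Suc by simp
  have "C (Suc i) =
      catching_strategy V E k (map (\<lambda>j. (C j, R j)) [0..<Suc i]) (R (Suc i))"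
    using assms(3) unfolding play_from_def by blast
  \<comment> \<open>The history has \<open>Suc i\<close> entries and ends in
    \<open>(C i, R i)\<close>, so the strategy aims at level \<open>k + 1 - Suc i\<close>, which is
    \<open>k - i\<close>.\<close>
  also have "\<dots> = Eps ?P"
    using ex by (simp add: catching_strategy_def Let_def)
  finally have "?P (C (Suc i))"
    using someI_ex[OF ex] by simp
  moreover have "k - i = Suc (k - Suc i)" using Suc.prems by simp
  moreover have "R (Suc i) \<in> V"
    using move assms(1) by (auto simp: reflexive_graph_def)
  ultimately show ?case using k_caught_Suc_imp_k_cornered by metis
qed

theorem theorem4p9:
  fixes V :: "'a set" and E :: "('a \<times> 'a) set" and k :: nat and c x :: 'a
  assumes "reflexive_graph V E"
    and "c \<in> V" and "x \<in> V"
    and "k_cornered V E k c x \<or> k_caught V E (k + 1) c x"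
  shows "cop_can_win_within V E k c x"
proof -
  have cornered: "k_cornered V E k c x"
    using assms k_caught_Suc_imp_k_cornered by fastforce
  \<comment> \<open>After \<open>k\<close> rounds the level is 0, which means coincidence. Plays
    continue formally past an earlier capture, so round \<open>k\<close> serves as witness in every
    case.\<close>
  have "C k = R k" if "play_from E (catching_strategy V E k) c x C R" for C R
    using catching_strategy_keeps_cornered[OF assms(1) cornered that, of k]
    by (simp add: k_cornered_def)
  then show ?thesis
    using legal_catching_strategy[OF assms(1)] unfolding cop_can_win_within_def by blast
qed

end
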